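(* Let $X$ be a real or complex locally convex space endowed with a saturated family $\{\|\cdot\|_\lambda\}_{\lambda\in\Lambda}$ of seminorms defining the topology of $X$. Let $\mathcal{F}=\{k_\lambda\}_{\lambda\in\Lambda}$ be a family of nonnegative constants and let $T:K\subseteq X\to X$ be a weakly inward $\mathcal{F}$-contractive function. Then $T$ has a fixed point, i.e. there is $x\in K$ with $T(x)=x$.
   Context: Saturated means that for all $\lambda,\mu\in\Lambda$ there is $\nu\in\Lambda$ with $\max\{\|x\|_\lambda,\|x\|_\mu\}\le\|x\|_\nu$ for all $x\in X$. That $T:K\to X$ is $\mathcal{F}$-contractive, for $\mathcal{F}=\{k_\lambda\}_{\lambda\in\Lambda}$, means that $0\le k_\lambda<1$ for each $\lambda\in\Lambda$ and $\|T(x)-T(y)\|_\lambda\le k_\lambda\|x-y\|_\lambda$ for all $x,y\in K$ and $\lambda\in\Lambda$. For a subset $K$ of $X$ and $x\in K$, the inner set of $K$ at $x$ is $I_K(x)=x+\{c(y-x):y\in K,\ c\ge1\}$, and its envelope is $$\widetilde{I}_K(x)=\bigcup_{z\in I_K(x)}\ \bigcap_{\lambda\in\Lambda,\ \eta>0}\{t\in X:\|t-z\|_\lambda\le\eta\|t-x\|_\lambda\}.$$ $T$ is weakly inward if $T(x)\in\widetilde{I}_K(x)$ for each $x\in K$.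
   Formalization: The claim fails as stated (e.g. X=ℝ, K=(0,1), T(x)=x/2; K empty; X=ℝ with the zero seminorm, K=X, T(x)=x+1), so it is proved with X assumed Hausdorff and K assumed nonempty and sequentially complete. *)

theory Defs
  imports Complex_Main
begin

text \<open>
  The scalar field is an arbitrary type of class \<open>real_normed_field\<close>. By the theorems of Ostrowski and
  Gelfand--Mazur, such a field is isometrically isomorphic to the reals or to the complex numbers, so
  this covers precisely the real and the complex vector spaces.
\<close>

definition seminorm :: "('k::real_normed_field \<Rightarrow> 'a::ab_group_add \<Rightarrow> 'a) \<Rightarrow> ('a \<Rightarrow> real) \<Rightarrow> bool" where
  "seminorm scale p \<longleftrightarrow>
     (\<forall>x. 0 \<le> p x) \<and>
     (\<forall>x y. p (x + y) \<le> p x + p y) \<and>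
     (\<forall>c x. p (scale c x) = norm c * p x)"

definition defines_topology :: "'l set \<Rightarrow> ('l \<Rightarrow> 'a::{ab_group_add,topological_space} \<Rightarrow> real) \<Rightarrow> bool" where
  "defines_topology \<Lambda> p \<longleftrightarrow>
     (\<forall>U. open U \<longleftrightarrow>
        (\<forall>x\<in>U. \<exists>F e. finite F \<and> F \<subseteq> \<Lambda> \<and> 0 < e \<and> {y. \<forall>l\<in>F. p l (y - x) < e} \<subseteq> U))"

text \<open>Local convexity is expressed by the existence of a defining family of seminorms.
  A topology defined by seminorms is automatically a vector space topology.
  It is taken to be Hausdorff, which is the role of the class \<open>t2_space\<close>.\<close>

definition locally_convex_space ::
  "('k::real_normed_field \<Rightarrow> 'a::{ab_group_add,t2_space} \<Rightarrow> 'a) \<Rightarrow> 'l set \<Rightarrow> ('l \<Rightarrow> 'a \<Rightarrow> real) \<Rightarrow> bool" where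
  "locally_convex_space scale \<Lambda> p \<longleftrightarrow>
     vector_space scale \<and> (\<forall>l\<in>\<Lambda>. seminorm scale (p l)) \<and> defines_topology \<Lambda> p"

definition saturated :: "'l set \<Rightarrow> ('l \<Rightarrow> 'a \<Rightarrow> real) \<Rightarrow> bool" where
  "saturated \<Lambda> p \<longleftrightarrow> (\<forall>l\<in>\<Lambda>. \<forall>m\<in>\<Lambda>. \<exists>n\<in>\<Lambda>. \<forall>x. max (p l x) (p m x) \<le> p n x)"

definition contractive ::
  "'l set \<Rightarrow> ('l \<Rightarrow> 'a::ab_group_add \<Rightarrow> real) \<Rightarrow> ('l \<Rightarrow> real) \<Rightarrow> 'a set \<Rightarrow> ('a \<Rightarrow> 'a) \<Rightarrow> bool" where
  "contractive \<Lambda> p k K T \<longleftrightarrow>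
     (\<forall>l\<in>\<Lambda>. 0 \<le> k l \<and> k l < 1) \<and>
     (\<forall>x\<in>K. \<forall>y\<in>K. \<forall>l\<in>\<Lambda>. p l (T x - T y) \<le> k l * p l (x - y))"

definition inner_set ::
  "('k::real_normed_field \<Rightarrow> 'a::ab_group_add \<Rightarrow> 'a) \<Rightarrow> 'a set \<Rightarrow> 'a \<Rightarrow> 'a set" where
  "inner_set scale K x = (\<lambda>v. x + v) ` {scale (of_real c) (y - x) | c y. y \<in> K \<and> 1 \<le> c}"

definition inner_envelope ::
  "('k::real_normed_field \<Rightarrow> 'a::ab_group_add \<Rightarrow> 'a) \<Rightarrow> 'l set \<Rightarrow> ('l \<Rightarrow> 'a \<Rightarrow> real) \<Rightarrow> 'a set \<Rightarrow> 'a \<Rightarrow> 'a set" where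
  "inner_envelope scale \<Lambda> p K x =
     (\<Union>z\<in>inner_set scale K x. \<Inter>l\<in>\<Lambda>. \<Inter>\<eta>\<in>{0<..}. {t. p l (t - z) \<le> \<eta> * p l (t - x)})"

definition weakly_inward ::
  "('k::real_normed_field \<Rightarrow> 'a::ab_group_add \<Rightarrow> 'a) \<Rightarrow> 'l set \<Rightarrow> ('l \<Rightarrow> 'a \<Rightarrow> real) \<Rightarrow> 'a set \<Rightarrow> ('a \<Rightarrow> 'a) \<Rightarrow> bool" where
  "weakly_inward scale \<Lambda> p K T \<longleftrightarrow> (\<forall>x\<in>K. T x \<in> inner_envelope scale \<Lambda> p K x)"

text \<open>Sequential completeness of a subset, with respect to the uniform structure that the topology
  and the addition induce. The library's \<open>Cauchy\<close> and \<open>complete\<close> need a metric or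
  a uniform space class. Every complete subset is sequentially complete, and so is every closed subset
  of a complete space. The fixed point theorem fails without such an assumption: halving maps
  the open unit interval into itself and has no fixed point there.\<close>

definition sequentially_complete :: "'a::{ab_group_add,topological_space} set \<Rightarrow> bool" where
  "sequentially_complete K \<longleftrightarrow>
     (\<forall>s :: nat \<Rightarrow> 'a.
        (\<forall>n. s n \<in> K) \<and>
        (\<forall>U. open U \<and> 0 \<in> U \<longrightarrow> (\<exists>N. \<forall>m\<ge>N. \<forall>n\<ge>N. s m - s n \<in> U))
        \<longrightarrow> (\<exists>x\<in>K. s \<longlonglongrightarrow> x))"

end

theory Submission
  imports Defs
begin

text \<open>
  Since the space is Hausdorff, \<open>T x\<close> lies in the inner set itself, so some point
  \<open>y = x + t (T x - x)\<close> with \<open>0 < t \<le> 1\<close> is in \<open>K\<close>. Passing from \<open>x\<close> to \<open>y\<close> multiplies every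
  displacement \<open>p l (T x - x)\<close> by at most \<open>1 - t (1 - k l) \<le> exp (- (1 - k l) t)\<close>, with the same \<open>t\<close>
  for all \<open>l\<close>, and \<open>(1 - k l) p l (y - x)\<close> is at most the loss of displacement. Moves of this kind
  compose, their times \<open>t\<close> adding up. Choose a sequence of moves each of which takes at least half
  of the time available (truncated at 1). It is Cauchy, and a further step of time \<open>t\<close> from its limit
  is available from every point of the sequence, so all the chosen times are at least \<open>t / 2\<close>.
  Hence the total time is infinite and all displacements tend to 0. Because the times do not depend
  on \<open>l\<close>, one sequence serves even an uncountable family of seminorms, and sequential completeness
  suffices.
\<close>

section \<open>Topology and completeness in terms of seminorms\<close>

locale locally_convex =
  fixes scale :: "'k::real_normed_field \<Rightarrow> 'a::{ab_group_add,t2_space} \<Rightarrow> 'a"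
    and \<Lambda> :: "'l set"
    and p :: "'l \<Rightarrow> 'a \<Rightarrow> real"
  assumes lcs: "locally_convex_space scale \<Lambda> p"
begin

sublocale vector_space scale
  using lcs by (simp add: locally_convex_space_def)

lemma
  assumes "l \<in> \<Lambda>"
  shows p_nonneg: "0 \<le> p l x"
    and p_triangle: "p l (x + y) \<le> p l x + p l y"
    and p_scale: "p l (scale c x) = norm c * p l x"
  using lcs assms by (auto simp: locally_convex_space_def seminorm_def)

lemma p_zero: "l \<in> \<Lambda> \<Longrightarrow> p l 0 = 0"
  using p_scale[of l 0 0] by simp

lemma p_minus_commute: "l \<in> \<Lambda> \<Longrightarrow> p l (x - y) = p l (y - x)"
  using p_scale[of l "-1" "x - y"] by simp

lemma p_diff_triangle: "l \<in> \<Lambda> \<Longrightarrow> p l (x - z) \<le> p l (x - y) + p l (y - z)"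
  using p_triangle[of l "x - y" "y - z"] by simp

lemma open_iff:
  "open U \<longleftrightarrow> (\<forall>x\<in>U. \<exists>F e. finite F \<and> F \<subseteq> \<Lambda> \<and> 0 < e \<and> {y. \<forall>l\<in>F. p l (y - x) < e} \<subseteq> U)"
  using lcs unfolding locally_convex_space_def defines_topology_def by blast

lemma open_p_ball:
  assumes l: "l \<in> \<Lambda>"
  shows "open {y. p l (y - x) < e}"
  unfolding open_iff
proof
  fix u assume "u \<in> {y. p l (y - x) < e}"
  moreover have "{y. \<forall>m\<in>{l}. p m (y - u) < e - p l (u - x)} \<subseteq> {y. p l (y - x) < e}"
  proof clarsimp
    fix y assume "p l (y - u) < e - p l (u - x)"
    then show "p l (y - x) < e"
      using p_diff_triangle[OF l, of y x u] by linarith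
  qed
  ultimately show "\<exists>F d. finite F \<and> F \<subseteq> \<Lambda> \<and> 0 < d \<and>
      {y. \<forall>m\<in>F. p m (y - u) < d} \<subseteq> {y. p l (y - x) < e}"
    using l by (intro exI[of _ "{l}"] exI[of _ "e - p l (u - x)"]) auto
qed

text \<open>The Hausdorff property enters here: a point at distance 0 from \<open>y\<close> in every
  seminorm lies in each basic neighbourhood of \<open>y\<close>.\<close>

lemma eq_if_p_zero:
  assumes "\<And>l. l \<in> \<Lambda> \<Longrightarrow> p l (x - y) = 0"
  shows "x = y"
proof (rule ccontr)
  assume "x \<noteq> y"
  then obtain U where U: "open U" "y \<in> U" "x \<notin> U"
    using hausdorff[of x y] by blast
  then obtain F e where "F \<subseteq> \<Lambda>" "0 < e" "{z. \<forall>l\<in>F. p l (z - y) < e} \<subseteq> U"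
    using open_iff[THEN iffD1, rule_format, OF U(1,2)] by blast
  moreover from this(1,2) have "x \<in> {z. \<forall>l\<in>F. p l (z - y) < e}"
    using assms by (simp add: subset_iff)
  ultimately show False
    using U(3) by blast
qed

lemma tendsto_p_diff:
  assumes l: "l \<in> \<Lambda>" and lim: "s \<longlonglongrightarrow> x"
  shows "(\<lambda>n. p l (s n - x)) \<longlonglongrightarrow> 0"
proof (rule LIMSEQ_I)
  fix r :: real assume "0 < r"
  then have "\<forall>\<^sub>F n in sequentially. s n \<in> {y. p l (y - x) < r}"
    using lim open_p_ball[OF l] p_zero[OF l] by (intro topological_tendstoD) auto
  then show "\<exists>N. \<forall>n\<ge>N. norm (p l (s n - x) - 0) < r"
    using p_nonneg[OF l] by (auto simp: eventually_sequentially)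
qed

lemma sequentially_complete_convergent:
  assumes K: "sequentially_complete K" and s: "\<And>n. s n \<in> K"
    and Cauchy: "\<And>l e. l \<in> \<Lambda> \<Longrightarrow> 0 < e \<Longrightarrow> \<exists>N. \<forall>m\<ge>N. \<forall>n\<ge>N. p l (s m - s n) < e"
  shows "\<exists>x\<in>K. s \<longlonglongrightarrow> x"
proof -
  have "\<exists>N. \<forall>m\<ge>N. \<forall>n\<ge>N. s m - s n \<in> U" if "open U" "0 \<in> U" for U
  proof -
    obtain F e where F: "finite F" "F \<subseteq> \<Lambda>" "0 < e" "{y. \<forall>l\<in>F. p l (y - 0) < e} \<subseteq> U"
      using open_iff[THEN iffD1, rule_format, OF \<open>open U\<close> \<open>0 \<in> U\<close>] by blast
    then have "\<forall>l\<in>F. \<exists>N. \<forall>m\<ge>N. \<forall>n\<ge>N. p l (s m - s n) < e"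
      using Cauchy by blast
    then obtain N where N: "\<And>l m n. l \<in> F \<Longrightarrow> N l \<le> m \<Longrightarrow> N l \<le> n \<Longrightarrow> p l (s m - s n) < e"
      by metis
    \<comment> \<open>For empty \<open>F\<close> the maximum is an unspecified number, which is
      harmless because \<open>U\<close> is then the whole space.\<close>
    have "s m - s n \<in> U" if "Max (N ` F) \<le> m" "Max (N ` F) \<le> n" for m n
    proof -
      have "N l \<le> Max (N ` F)" if "l \<in> F" for l
        using F(1) that by simp
      then have "p l (s m - s n) < e" if "l \<in> F" for l
        using N[OF that, of m n] \<open>Max (N ` F) \<le> m\<close> \<open>Max (N ` F) \<le> n\<close> that
        by (meson order_trans)
      then have "s m - s n \<in> {y. \<forall>l\<in>F. p l (y - 0) < e}"
        by simp
      with F(4) show ?thesis by blast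
    qed
    then show ?thesis by blast
  qed
  with K s show ?thesis
    unfolding sequentially_complete_def by blast
qed

text \<open>The point \<open>z\<close> is chosen before \<open>\<eta>\<close>, so letting
  \<open>\<eta>\<close> tend to 0 forces \<open>p l (t - z) = 0\<close> for every
  \<open>l\<close>.\<close>

lemma inner_envelope_eq_inner_set: "inner_envelope scale \<Lambda> p K x = inner_set scale K x"
proof
  show "inner_envelope scale \<Lambda> p K x \<subseteq> inner_set scale K x"
  proof
    fix t assume "t \<in> inner_envelope scale \<Lambda> p K x"
    then obtain z where z: "z \<in> inner_set scale K x"
      and small: "\<And>l \<eta>. l \<in> \<Lambda> \<Longrightarrow> 0 < \<eta> \<Longrightarrow> p l (t - z) \<le> \<eta> * p l (t - x)"
      by (auto simp: inner_envelope_def)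
    have "t = z"
    proof (rule eq_if_p_zero)
      fix l assume l: "l \<in> \<Lambda>"
      have "p l (t - z) \<le> 0 + e" if "0 < e" for e
      proof -
        \<comment> \<open>Adding 1 keeps the denominator of the chosen \<open>\<eta>\<close>
          positive even if \<open>p l (t - x) = 0\<close>.\<close>
        have pos: "0 < p l (t - x) + 1"
          using p_nonneg[OF l, of "t - x"] by linarith
        have "p l (t - z) \<le> e / (p l (t - x) + 1) * p l (t - x)"
          by (rule small[OF l]) (use pos that in simp)
        also have "\<dots> \<le> e"
          using pos that by (simp add: field_simps)
        finally show ?thesis by simp
      qed
      then have "p l (t - z) \<le> 0"
        by (rule field_le_epsilon)
      then show "p l (t - z) = 0"
        using p_nonneg[OF l, of "t - z"] by simp
    qed
    with z show "t \<in> inner_set scale K x" by simp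
  qed
  show "inner_set scale K x \<subseteq> inner_envelope scale \<Lambda> p K x"
  proof
    fix z assume z: "z \<in> inner_set scale K x"
    have "p l (z - z) \<le> \<eta> * p l (z - x)" if "l \<in> \<Lambda>" "0 < \<eta>" for l \<eta>
      using that by (simp add: p_zero p_nonneg)
    with z show "z \<in> inner_envelope scale \<Lambda> p K x"
      unfolding inner_envelope_def by blast
  qed
qed

end

section \<open>Moves and the decay of displacement\<close>

locale locally_convex_contraction = locally_convex +
  fixes k :: "'c \<Rightarrow> real" and K :: "'b set" and T :: "'b \<Rightarrow> 'b"
  assumes contr: "contractive \<Lambda> p k K T"
begin

lemma
  assumes "l \<in> \<Lambda>"
  shows k_nonneg: "0 \<le> k l"
    and k_less_1: "k l < 1"
    and p_contr: "x \<in> K \<Longrightarrow> y \<in> K \<Longrightarrow> p l (T x - T y) \<le> k l * p l (x - y)"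
  using contr assms by (auto simp: contractive_def)

definition displacement :: "'c \<Rightarrow> 'b \<Rightarrow> real" where
  "displacement l x = p l (T x - x)"

text \<open>The model is the flow of \<open>T x - x\<close>, along which the displacement decays at
  rate \<open>1 - k l\<close>. The exponential makes times additive under composition. The second
  inequality is of Caristi type: distance is paid for by loss of displacement, so it telescopes.
  Both survive limits, and \<open>t\<close> is common to all seminorms.\<close>

definition move :: "'b \<Rightarrow> 'b \<Rightarrow> real \<Rightarrow> bool" where
  "move x y t \<longleftrightarrow> (\<forall>l\<in>\<Lambda>.
     displacement l y \<le> exp (- ((1 - k l) * t)) * displacement l x \<and>
     (1 - k l) * p l (y - x) \<le> displacement l x - displacement l y)"

lemma displacement_nonneg: "l \<in> \<Lambda> \<Longrightarrow> 0 \<le> displacement l x"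
  by (simp add: displacement_def p_nonneg)

text \<open>The constant 2 bounds \<open>1 + k l\<close>: one term comes from the point, the other
  from its image.\<close>

lemma displacement_lipschitz:
  assumes l: "l \<in> \<Lambda>" and xy: "x \<in> K" "y \<in> K"
  shows "\<bar>displacement l x - displacement l y\<bar> \<le> 2 * p l (x - y)"
proof -
  have "displacement l u - displacement l v \<le> 2 * p l (u - v)" if "u \<in> K" "v \<in> K" for u v
  proof -
    have "p l (T u - u) \<le> p l (T u - T v) + p l (T v - v) + p l (v - u)"
      using p_diff_triangle[OF l, of "T u" u "T v"] p_diff_triangle[OF l, of "T v" u v] by linarith
    moreover have "p l (T u - T v) \<le> 1 * p l (u - v)"
      using p_contr[OF l that] mult_right_mono[of "k l" 1 "p l (u - v)"] k_less_1[OF l]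
        p_nonneg[OF l] by (meson less_imp_le order_trans)
    ultimately show ?thesis
      using p_minus_commute[OF l, of u v] by (simp add: displacement_def)
  qed
  from this[OF xy] this[OF xy(2,1)] show ?thesis
    using p_minus_commute[OF l, of x y] by linarith
qed

lemma move_refl: "move x x 0"
  by (simp add: move_def p_zero)

lemma move_trans:
  assumes "move x y s" "move y z t"
  shows "move x z (s + t)"
  unfolding move_def
proof (intro ballI conjI)
  fix l assume l: "l \<in> \<Lambda>"
  note xy = assms(1)[unfolded move_def, rule_format, OF l]
  note yz = assms(2)[unfolded move_def, rule_format, OF l]
  have "displacement l z \<le> exp (- ((1 - k l) * t)) * displacement l y"
    using yz by simp
  also have "\<dots> \<le> exp (- ((1 - k l) * t)) * (exp (- ((1 - k l) * s)) * displacement l x)"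
    using xy by (simp add: mult_left_mono)
  also have "\<dots> = exp (- ((1 - k l) * (s + t))) * displacement l x"
    unfolding mult.assoc[symmetric] exp_add[symmetric] by (simp add: algebra_simps)
  finally show "displacement l z \<le> exp (- ((1 - k l) * (s + t))) * displacement l x" .
  have "(1 - k l) * p l (z - x) \<le> (1 - k l) * (p l (z - y) + p l (y - x))"
    using k_less_1[OF l] p_diff_triangle[OF l] by (intro mult_left_mono) auto
  then show "(1 - k l) * p l (z - x) \<le> displacement l x - displacement l z"
    using xy yz by (simp add: distrib_left)
qed

lemma move_mono:
  assumes "move x y t" "s \<le> t"
  shows "move x y s"
  unfolding move_def
proof (intro ballI conjI)
  fix l assume l: "l \<in> \<Lambda>"
  note xy = assms(1)[unfolded move_def, rule_format, OF l]
  have "exp (- ((1 - k l) * t)) * displacement l x \<le> exp (- ((1 - k l) * s)) * displacement l x"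
    using assms(2) k_less_1[OF l] displacement_nonneg[OF l]
    by (intro mult_right_mono) (auto intro: mult_left_mono)
  then show "displacement l y \<le> exp (- ((1 - k l) * s)) * displacement l x"
    using xy by linarith
  show "(1 - k l) * p l (y - x) \<le> displacement l x - displacement l y"
    using xy by simp
qed

text \<open>The point \<open>y\<close> lies at the fraction \<open>1 / c\<close> of the way from
  \<open>x\<close> to \<open>T x\<close>, and this fraction is the time.\<close>

lemma move_inward:
  assumes "x \<in> K" and inward: "T x \<in> inner_set scale K x"
  shows "\<exists>y\<in>K. \<exists>t. 0 < t \<and> t \<le> 1 \<and> move x y t"
proof -
  obtain c y where y: "y \<in> K" and c: "1 \<le> c" and Tx: "T x = x + scale (of_real c) (y - x)"
    using inward by (auto simp: inner_set_def)
  have Tx_x: "T x - x = scale (of_real c) (y - x)"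
    using Tx by simp
  have Tx_y: "T x - y = scale (of_real (c - 1)) (y - x)"
    using Tx by (simp add: scale_left_diff_distrib)
  have "move x y (1 / c)"
    unfolding move_def
  proof (intro ballI conjI)
    fix l assume l: "l \<in> \<Lambda>"
    define d where "d = p l (y - x)"
    have x_eq: "displacement l x = c * d"
      unfolding displacement_def Tx_x p_scale[OF l] d_def using c by simp
    \<comment> \<open>Here \<open>1 \<le> c\<close> removes the absolute value of
      \<open>c - 1\<close>.\<close>
    have "p l (T x - y) = (c - 1) * d"
      unfolding Tx_y p_scale[OF l] d_def norm_of_real using c by simp
    moreover have "p l (T y - T x) \<le> k l * d"
      using p_contr[OF l y \<open>x \<in> K\<close>] by (simp add: d_def)
    ultimately have y_le: "displacement l y \<le> (k l + c - 1) * d"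
      using p_diff_triangle[OF l, of "T y" y "T x"] by (simp add: displacement_def algebra_simps)
    \<comment> \<open>The bound is rewritten as a multiple of \<open>c * d\<close>, the displacement
      at \<open>x\<close>, so that \<open>1 + u \<le> exp u\<close> applies.\<close>
    have "displacement l y \<le> (1 + - ((1 - k l) * (1 / c))) * (c * d)"
      using y_le c by (simp add: algebra_simps)
    also have "\<dots> \<le> exp (- ((1 - k l) * (1 / c))) * (c * d)"
      using c p_nonneg[OF l] by (intro mult_right_mono exp_ge_add_one_self) (simp add: d_def)
    finally show "displacement l y \<le> exp (- ((1 - k l) * (1 / c))) * displacement l x"
      by (simp add: x_eq)
    show "(1 - k l) * p l (y - x) \<le> displacement l x - displacement l y"
      using y_le x_eq by (simp add: d_def algebra_simps)
  qed
  with y c show ?thesis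
    by (intro bexI[of _ y] exI[of _ "1 / c"]) auto
qed

text \<open>The supremum of the available times need not be attained, but some time exceeds half of
  it. Truncation at 1 keeps it finite: where all displacements vanish, staying put is a move of any
  time.\<close>

lemma move_half_optimal:
  assumes "y \<in> K" "move x y t" "0 < t" "t \<le> 1"
  shows "\<exists>y\<in>K. \<exists>t>0. move x y t \<and> (\<forall>z\<in>K. \<forall>s\<le>1. move x z s \<longrightarrow> s \<le> 2 * t)"
proof -
  define S where "S = {s. s \<le> 1 \<and> (\<exists>z\<in>K. move x z s)}"
  have "t \<in> S" and bdd: "bdd_above S"
    using assms by (auto simp: S_def bdd_above_def)
  then have "t \<le> Sup S"
    by (simp add: cSup_upper)
  then have "Sup S / 2 < Sup S"
    using \<open>0 < t\<close> by simp
  then obtain r where r: "r \<in> S" "Sup S / 2 < r"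
    using \<open>t \<in> S\<close> less_cSup_iff[of S "Sup S / 2"] bdd by blast
  then obtain z where "z \<in> K" "move x z r"
    by (auto simp: S_def)
  moreover have "0 < r"
    using r \<open>t \<le> Sup S\<close> \<open>0 < t\<close> by simp
  moreover have "s \<le> 2 * r" if "w \<in> K" "s \<le> 1" "move x w s" for w s
    using cSup_upper[of s S] bdd r that by (force simp: S_def)
  ultimately show ?thesis by blast
qed

section \<open>Infinite sequences of moves and their limits\<close>

context
  fixes X :: "nat \<Rightarrow> 'b" and \<tau> :: "nat \<Rightarrow> real"
  assumes X: "\<And>n. X n \<in> K" and mv: "\<And>n. move (X n) (X (Suc n)) (\<tau> n)" and \<tau>: "\<And>n. 0 < \<tau> n"
begin

text \<open>Time 0 keeps just the monotonicity of the displacement and the distance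
  estimate.\<close>

lemma moves_le: "m \<le> n \<Longrightarrow> move (X m) (X n) 0"
proof (induction n rule: dec_induct)
  case base
  show ?case by (rule move_refl)
next
  case (step n)
  then show ?case
    using move_trans[OF step.IH mv] move_mono \<tau>[of n] by fastforce
qed

lemma moves_total_time:
  assumes "\<And>n. t \<le> \<tau> n"
  shows "move (X 0) (X n) (real n * t)"
proof (induction n)
  case 0
  show ?case using move_refl by simp
next
  case (Suc n)
  show ?case
    using move_mono[OF move_trans[OF Suc mv]] assms[of n] by (simp add: algebra_simps)
qed

lemma moves_displacement_convergent:
  assumes l: "l \<in> \<Lambda>"
  shows "convergent (\<lambda>n. displacement l (X n))"
proof (rule Bseq_monoseq_convergent)
  have dec: "displacement l (X n) \<le> displacement l (X m)" if "m \<le> n" for m n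
    using moves_le[OF that] l by (simp add: move_def)
  show "monoseq (\<lambda>n. displacement l (X n))"
    using dec by (simp add: monoseq_def)
  show "Bseq (\<lambda>n. displacement l (X n))"
    using dec[of 0] displacement_nonneg[OF l] by (intro BseqI'[of _ "displacement l (X 0)"]) simp
qed

text \<open>Distances are controlled by differences of the convergent real sequence of
  displacements. The index may depend on \<open>l\<close>.\<close>

lemma moves_Cauchy:
  assumes l: "l \<in> \<Lambda>" and "0 < e"
  shows "\<exists>N. \<forall>m\<ge>N. \<forall>n\<ge>N. p l (X m - X n) < e"
proof -
  have k1: "0 < 1 - k l"
    using k_less_1[OF l] by simp
  have "Cauchy (\<lambda>n. displacement l (X n))"
    using moves_displacement_convergent[OF l] by (rule convergent_Cauchy)
  then obtain N where N: "\<And>m n. N \<le> m \<Longrightarrow> N \<le> n \<Longrightarrow>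
      \<bar>displacement l (X m) - displacement l (X n)\<bar> < (1 - k l) * e"
    using CauchyD[of _ "(1 - k l) * e"] k1 \<open>0 < e\<close> by fastforce
  have less: "p l (X n - X m) < e" if "N \<le> m" "m \<le> n" for m n
  proof -
    have "(1 - k l) * p l (X n - X m) \<le> displacement l (X m) - displacement l (X n)"
      using moves_le[OF \<open>m \<le> n\<close>] l by (simp add: move_def)
    also have "\<dots> < (1 - k l) * e"
      using N[of m n] that by simp
    finally show ?thesis
      using k1 by simp
  qed
  have "p l (X m - X n) < e" if "N \<le> m" "N \<le> n" for m n
    using less[of m n] less[of n m] p_minus_commute[OF l, of "X m" "X n"] that
    by (cases "m \<le> n") auto
  then show ?thesis by blast
qed

lemma moves_limit:
  assumes lim: "X \<longlonglongrightarrow> x" and x: "x \<in> K"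
  shows "move (X n) x 0"
  unfolding move_def
proof (intro ballI)
  fix l assume l: "l \<in> \<Lambda>"
  note p0 = tendsto_p_diff[OF l lim]
  have "(\<lambda>m. displacement l (X m) - displacement l x) \<longlonglongrightarrow> 0"
    using displacement_lipschitz[OF l X x] p_nonneg[OF l]
    by (intro tendsto_0_le[OF p0, of _ 2]) (simp add: mult.commute)
  then have disp: "(\<lambda>m. displacement l (X m)) \<longlonglongrightarrow> displacement l x"
    by (rule LIM_zero_cancel)
  \<comment> \<open>The triangle inequality replaces \<open>p l (X m - X n)\<close> by a lower bound
    whose limit is evident.\<close>
  have "(\<lambda>m. (1 - k l) * (p l (x - X n) - p l (X m - x)))
      \<longlonglongrightarrow> (1 - k l) * (p l (x - X n) - 0)"
    by (intro tendsto_intros p0)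
  moreover have "(\<lambda>m. displacement l (X n) - displacement l (X m))
      \<longlonglongrightarrow> displacement l (X n) - displacement l x"
    by (intro tendsto_intros disp)
  moreover have "(1 - k l) * (p l (x - X n) - p l (X m - x))
      \<le> displacement l (X n) - displacement l (X m)" if "n \<le> m" for m
  proof -
    have "(1 - k l) * (p l (x - X n) - p l (X m - x)) \<le> (1 - k l) * p l (X m - X n)"
      using k_less_1[OF l] p_diff_triangle[OF l, of x "X n" "X m"] p_minus_commute[OF l, of x "X m"]
      by (intro mult_left_mono) auto
    also have "\<dots> \<le> displacement l (X n) - displacement l (X m)"
      using moves_le[OF that] l by (simp add: move_def)
    finally show ?thesis .
  qed
  ultimately have *: "(1 - k l) * p l (x - X n) \<le> displacement l (X n) - displacement l x"
    using LIMSEQ_le by (metis (no_types, lifting) diff_zero)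
  \<comment> \<open>At time 0 the decay condition is monotonicity, which follows from the distance
    estimate because its left side is nonnegative.\<close>
  moreover have "0 \<le> (1 - k l) * p l (x - X n)"
    using k_less_1[OF l] p_nonneg[OF l] by simp
  ultimately show "displacement l x \<le> exp (- ((1 - k l) * 0)) * displacement l (X n) \<and>
      (1 - k l) * p l (x - X n) \<le> displacement l (X n) - displacement l x"
    by simp
qed

lemma moves_limit_fixed:
  assumes lim: "X \<longlonglongrightarrow> x" and x: "x \<in> K" and "0 < t" and t: "\<And>n. t \<le> \<tau> n"
  shows "T x = x"
proof (rule eq_if_p_zero)
  fix l assume l: "l \<in> \<Lambda>"
  \<comment> \<open>The first \<open>n\<close> moves take total time at least \<open>n * t\<close>,
    and the passage to the limit adds time 0. This yields a geometric factor with ratio below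
    1.\<close>
  have "displacement l x \<le> exp (- ((1 - k l) * t)) ^ n * displacement l (X 0)" for n
  proof -
    have "move (X 0) x (real n * t + 0)"
      by (rule move_trans[OF moves_total_time[OF t] moves_limit[OF lim x]])
    then show ?thesis
      using l by (simp add: move_def exp_of_nat_mult[symmetric] algebra_simps)
  qed
  moreover have "(\<lambda>n. exp (- ((1 - k l) * t)) ^ n * displacement l (X 0)) \<longlonglongrightarrow> 0"
    using k_less_1[OF l] \<open>0 < t\<close> by (intro tendsto_mult_left_zero LIMSEQ_realpow_zero) auto
  ultimately have "displacement l x \<le> 0"
    by (intro LIMSEQ_le_const) auto
  then show "p l (T x - x) = 0"
    using p_nonneg[OF l, of "T x - x"] by (simp add: displacement_def)
qed

end

theorem inward_fixed_point:
  assumes "K \<noteq> {}" and compl: "sequentially_complete K"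
    and inward: "\<And>x. x \<in> K \<Longrightarrow> T x \<in> inner_set scale K x"
  shows "\<exists>x\<in>K. T x = x"
proof -
  \<comment> \<open>A half-optimal move is fixed at every point of \<open>K\<close>, so the sequence
    is simply an orbit of the choice function \<open>f\<close>.\<close>
  have "\<forall>x\<in>K. \<exists>y t. y \<in> K \<and> 0 < t \<and> move x y t \<and>
      (\<forall>z\<in>K. \<forall>s\<le>1. move x z s \<longrightarrow> s \<le> 2 * t)"
  proof
    fix x assume "x \<in> K"
    then obtain y t where "y \<in> K" "0 < t" "t \<le> 1" "move x y t"
      using move_inward[OF _ inward] by blast
    then show "\<exists>y t. y \<in> K \<and> 0 < t \<and> move x y t \<and>
        (\<forall>z\<in>K. \<forall>s\<le>1. move x z s \<longrightarrow> s \<le> 2 * t)"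
      using move_half_optimal[of y x t] by blast
  qed
  then obtain f g where fg: "\<And>x. x \<in> K \<Longrightarrow> f x \<in> K \<and> 0 < g x \<and> move x (f x) (g x) \<and>
      (\<forall>z\<in>K. \<forall>s\<le>1. move x z s \<longrightarrow> s \<le> 2 * g x)"
    by metis
  obtain x0 where "x0 \<in> K"
    using \<open>K \<noteq> {}\<close> by blast
  define X where "X n = (f ^^ n) x0" for n
  have X: "X n \<in> K" for n
    by (induction n) (use \<open>x0 \<in> K\<close> fg in \<open>auto simp: X_def\<close>)
  have mv: "move (X n) (X (Suc n)) (g (X n))" and pos: "0 < g (X n)" for n
    using fg[OF X[of n]] by (auto simp: X_def)
  obtain x where x: "x \<in> K" "X \<longlonglongrightarrow> x"
    using sequentially_complete_convergent[OF compl X moves_Cauchy[of X "\<lambda>n. g (X n)",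
        OF X mv pos]] by blast
  obtain y t where y: "y \<in> K" "0 < t" "t \<le> 1" "move x y t"
    using move_inward[OF x(1) inward[OF x(1)]] by blast
  have "t / 2 \<le> g (X n)" for n
  proof -
    \<comment> \<open>This move passes through the limit \<open>x\<close>. Since
      \<open>t \<le> 1\<close>, it competes with the half-optimal choice at
      \<open>X n\<close>.\<close>
    have "move (X n) y t"
      using move_trans[OF moves_limit[of X "\<lambda>n. g (X n)", OF X mv pos x(2,1)] y(4)] by simp
    then have "t \<le> 2 * g (X n)"
      using fg[OF X[of n]] y by blast
    then show ?thesis by simp
  qed
  then have "T x = x"
    using moves_limit_fixed[of X "\<lambda>n. g (X n)", OF X mv pos x(2,1), of "t / 2"] y(2) by simp
  with x show ?thesis by blast
qed

end

theorem theorem22: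
  fixes scale :: "'k::real_normed_field \<Rightarrow> 'a::{ab_group_add,t2_space} \<Rightarrow> 'a"
    and \<Lambda> :: "'l set"
    and p :: "'l \<Rightarrow> 'a \<Rightarrow> real"
    and k :: "'l \<Rightarrow> real"
    and K :: "'a set"
    and T :: "'a \<Rightarrow> 'a"
  assumes "locally_convex_space scale \<Lambda> p"
    and "saturated \<Lambda> p"
    and "K \<noteq> {}"
    and "sequentially_complete K"
    and "contractive \<Lambda> p k K T"
    and "weakly_inward scale \<Lambda> p K T"
  shows "\<exists>x\<in>K. T x = x"
proof -
  interpret locally_convex_contraction scale \<Lambda> p k K T
    by unfold_locales (use assms in auto)
  show ?thesis
    using assms inward_fixed_point inner_envelope_eq_inner_set by (simp add: weakly_inward_def)
qed

end
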